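(* Let $R:\mathbb{R}^n\to\mathbb{R}\cup\{+\infty\}$ be proper, convex and lower semicontinuous, let $F:\mathbb{R}^n\to\mathbb{R}$ be convex and differentiable with $\frac1\beta$-Lipschitz continuous gradient ($\beta>0$), put $\Phi=F+R$ and assume $\mathrm{Argmin}(\Phi)\neq\emptyset$. Let $(x_k)_{k\in\mathbb{N}}$ be generated by the inertial Forward--Backward algorithm (described in the context) with $\bar a<1$, and with sequences $(a_k)_{k\in\mathbb{N}}$, $(b_k)_{k\in\mathbb{N}}$ such that $$\sum_{k\in\mathbb{N}}\max\{a_k,b_k\}\,\|x_k-x_{k-1}\|^2<+\infty .$$ Then there exists $x^\star\in\mathrm{Argmin}(\Phi)$ such that $(x_k)_{k\in\mathbb{N}}$ converges to $x^\star$.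
   Context: Inertial Forward--Backward algorithm: fix $\bar a\le 1$, $\bar b\le 1$, $\underline\epsilon,\bar\epsilon>0$ with $\underline\epsilon\le 2\beta-\bar\epsilon$, $x_0\in\mathbb{R}^n$, $x_{-1}=x_0$. For each $k\in\mathbb{N}$ choose $a_k\in[0,\bar a]$, $b_k\in[0,\bar b]$, $\gamma_k\in[\underline\epsilon,2\beta-\bar\epsilon]$ and set $$y_{a,k}=x_k+a_k(x_k-x_{k-1}),\quad y_{b,k}=x_k+b_k(x_k-x_{k-1}),\quad x_{k+1}=\mathrm{prox}_{\gamma_kR}\big(y_{a,k}-\gamma_k\nabla F(y_{b,k})\big),$$ where $\mathrm{prox}_{\gamma R}(z)=\mathrm{argmin}_{x\in\mathbb{R}^n}\frac12\|x-z\|^2+\gamma R(x)$. *)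

theory Defs
  imports "HOL-Analysis.Analysis"
begin

text \<open>Functions with values in the reals extended by plus infinity are rendered as
  \<^typ>\<open>ereal\<close>-valued functions; properness excludes the value minus infinity.\<close>

definition proper_fun :: "('a \<Rightarrow> ereal) \<Rightarrow> bool" where
  "proper_fun R \<longleftrightarrow> (\<forall>x. R x \<noteq> -\<infinity>) \<and> (\<exists>x. R x \<noteq> \<infinity>)"

text \<open>Endpoints \<open>t = 0\<close> and \<open>t = 1\<close> are harmless because \<open>0 * \<infinity> = 0\<close> in \<^typ>\<open>ereal\<close>.\<close>

definition ereal_convex :: "('a::real_vector \<Rightarrow> ereal) \<Rightarrow> bool" where
  "ereal_convex R \<longleftrightarrow>
     (\<forall>x y. \<forall>t\<in>{0..1::real}.
        R ((1 - t) *\<^sub>R x + t *\<^sub>R y) \<le> ereal (1 - t) * R x + ereal t * R y)"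

definition lower_semicontinuous :: "('a::topological_space \<Rightarrow> ereal) \<Rightarrow> bool" where
  "lower_semicontinuous R \<longleftrightarrow> (\<forall>x. R x \<le> Liminf (at x) R)"

definition Argmin :: "('a \<Rightarrow> ereal) \<Rightarrow> 'a set" where
  "Argmin f = {x. is_arg_min f (\<lambda>_. True) x}"

text \<open>For \<open>\<gamma> > 0\<close> and \<open>R\<close> proper, convex and lower semicontinuous, the minimiser exists and is
  unique, so the choice made by \<^const>\<open>arg_min\<close> is immaterial.\<close>

definition prox :: "real \<Rightarrow> ('a::euclidean_space \<Rightarrow> ereal) \<Rightarrow> 'a \<Rightarrow> 'a" where
  "prox \<gamma> R z = arg_min (\<lambda>x. ereal (1/2 * (norm (x - z))\<^sup>2) + ereal \<gamma> * R x) (\<lambda>_. True)"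

text \<open>The predecessor of the \<open>k\<close>-th term, with the convention that the term of index \<open>-1\<close>
  equals the term of index \<open>0\<close>.\<close>

definition prev :: "(nat \<Rightarrow> 'a) \<Rightarrow> nat \<Rightarrow> 'a" where
  "prev x k = (case k of 0 \<Rightarrow> x 0 | Suc j \<Rightarrow> x j)"

text \<open>\<open>x\<close> is a run of the inertial Forward--Backward algorithm with starting point \<open>x 0\<close>, gradient
  map \<open>gradF\<close>, parameters \<open>abar, bbar, eps_lo, eps_hi\<close> and choices \<open>a k, b k, \<gamma> k\<close>.\<close>

definition inertial_forward_backward ::
  "real \<Rightarrow> ('a::euclidean_space \<Rightarrow> 'a) \<Rightarrow> ('a \<Rightarrow> ereal) \<Rightarrow> real \<Rightarrow> real \<Rightarrow> real \<Rightarrow> real \<Rightarrow>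
   (nat \<Rightarrow> real) \<Rightarrow> (nat \<Rightarrow> real) \<Rightarrow> (nat \<Rightarrow> real) \<Rightarrow> (nat \<Rightarrow> 'a) \<Rightarrow> bool" where
  "inertial_forward_backward \<beta> gradF R abar bbar eps_lo eps_hi a b \<gamma> x \<longleftrightarrow>
     abar \<le> 1 \<and> bbar \<le> 1 \<and> eps_lo > 0 \<and> eps_hi > 0 \<and> eps_lo \<le> 2 * \<beta> - eps_hi \<and>
     (\<forall>k. a k \<in> {0..abar} \<and> b k \<in> {0..bbar} \<and> \<gamma> k \<in> {eps_lo..2 * \<beta> - eps_hi} \<and>
       (let y\<^sub>a = x k + a k *\<^sub>R (x k - prev x k);
            y\<^sub>b = x k + b k *\<^sub>R (x k - prev x k)
        in x (Suc k) = prox (\<gamma> k) R (y\<^sub>a - \<gamma> k *\<^sub>R gradF y\<^sub>b)))"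

end

theory Submission
  imports Defs
begin

text \<open>
  Comparing the subgradient inequalities of \<open>R\<close> at \<open>x (k + 1)\<close> and at a minimiser \<open>w\<close>, and using that
  \<open>gradF\<close> is cocoercive (Baillon and Haddad), one finds for \<open>\<phi> k = \<parallel>x k - w\<parallel>\<^sup>2\<close> that
  \<open>\<phi> (k + 1) - \<phi> k\<close> is at most \<open>a k * (\<phi> k - \<phi> (k - 1))\<close>, plus a multiple of the summable
  inertia term, minus a multiple of \<open>\<parallel>x (k + 1) - x k\<parallel>\<^sup>2\<close>; only cocoercivity allows step sizes up to
  \<open>2 * \<beta>\<close> here. Since \<open>a k\<close> stays away from 1, \<open>\<phi>\<close> converges and \<open>x (k + 1) - x k\<close> tends to 0.
  Hence the optimality conditions of the proximal steps pass to the limit along convergent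
  subsequences, so every cluster point is a minimiser, and Opial's argument yields convergence.
\<close>

section \<open>Lower semicontinuity and existence of proximal points\<close>

text \<open>A real \<open>y\<close> strictly between \<open>m\<close> and \<open>R l\<close> would
  lie below \<open>R\<close> near \<open>l\<close> but eventually above \<open>c n\<close>. The
  bound moves with \<open>n\<close> because the optimality inequalities of the iterates do.\<close>

lemma lower_semicontinuous_le_lim:
  fixes R :: "'a::t1_space \<Rightarrow> ereal"
  assumes lsc: "lower_semicontinuous R" and u: "u \<longlonglongrightarrow> l" and c: "c \<longlonglongrightarrow> m"
    and le: "\<And>n. R (u n) \<le> ereal (c n)"
  shows "R l \<le> ereal m"
proof (rule ccontr)
  assume "\<not> R l \<le> ereal m"
  then obtain y where y: "ereal m < ereal y" "ereal y < R l"
    by (metis ereal_dense2 not_le)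
  have "eventually (\<lambda>x. ereal y < R x) (at l)"
    using lsc y(2) unfolding lower_semicontinuous_def
    by (metis le_Liminf_iff)
  \<comment> \<open>\<open>lower_semicontinuous\<close> speaks of punctured neighbourhoods; the
    point \<open>l\<close> itself is added because \<open>u\<close> may visit it.\<close>
  then have "eventually (\<lambda>x. ereal y < R x) (nhds l)"
    using y(2) by (auto simp: eventually_at_filter elim: eventually_mono)
  then have "eventually (\<lambda>n. ereal y < R (u n)) sequentially"
    by (rule eventually_compose_filterlim[OF _ u])
  moreover have "eventually (\<lambda>n. c n < y) sequentially"
    using c y(1) by (simp add: order_tendstoD(2))
  ultimately have "eventually (\<lambda>n. False) sequentially"
  proof eventually_elim
    case (elim n)
    with le[of n] show ?case by (metis less_ereal.simps(1) order.strict_trans not_less)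
  qed
  then show False by simp
qed

text \<open>A continuous bound \<open>c\<close> covers the proximal objective: its quadratic term
  can be moved to the right-hand side.\<close>

lemma closed_lower_semicontinuous_le:
  fixes R :: "'a::metric_space \<Rightarrow> ereal"
  assumes "lower_semicontinuous R" "continuous_on UNIV c"
  shows "closed {x. R x \<le> ereal (c x)}"
  unfolding closed_sequential_limits
proof (intro allI impI, elim conjE)
  fix u l assume u: "\<forall>n. u n \<in> {x. R x \<le> ereal (c x)}" "u \<longlonglongrightarrow> l"
  have "(\<lambda>n. c (u n)) \<longlonglongrightarrow> c l"
    using assms(2) u(2) by (auto intro: continuous_on_tendsto_compose)
  with u show "l \<in> {x. R x \<le> ereal (c x)}"
    using lower_semicontinuous_le_lim[OF assms(1) u(2)] by auto
qed

text \<open>Without a minimiser, the open sets \<open>{x. g u < g x}\<close> would cover the compact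
  sublevel set; in a finite subcover, the index with the least value of \<open>g\<close> is left
  uncovered.\<close>

lemma ex_is_arg_min_compact_sublevel:
  fixes g :: "'a::heine_borel \<Rightarrow> ereal"
  assumes not_bot: "\<And>x. g x \<noteq> -\<infinity>"
    and closed: "\<And>s::real. closed {x. g x \<le> ereal s}"
    and bounded: "bounded {x. g x \<le> ereal s}"
    and w: "g w \<le> ereal s"
  shows "\<exists>p. is_arg_min g (\<lambda>_. True) p"
proof (rule ccontr)
  assume "\<not> ?thesis"
  then have smaller: "\<exists>y. g y < g p" for p by (auto simp: is_arg_min_def)
  let ?K = "{x. g x \<le> ereal s}"
  have op: "open {x. g u < g x}" if "u \<in> ?K" for u
  proof -
    from that not_bot[of u] obtain r where "g u = ereal r" by (cases "g u") auto
    moreover have "{x. ereal r < g x} = - {x. g x \<le> ereal r}" by auto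
    ultimately show ?thesis using closed by auto
  qed
  have cover: "?K \<subseteq> (\<Union>u\<in>?K. {x. g u < g x})"
  proof
    fix p assume p: "p \<in> ?K"
    from smaller obtain y where "g y < g p" by blast
    moreover from this p have "y \<in> ?K" by auto
    ultimately show "p \<in> (\<Union>u\<in>?K. {x. g u < g x})" by blast
  qed
  have "compact ?K" using closed bounded by (simp add: compact_eq_bounded_closed)
  then obtain C where C: "C \<subseteq> ?K" "finite C" "?K \<subseteq> (\<Union>u\<in>C. {x. g u < g x})"
    using op cover by (rule compactE_image)
  from C(3) w have "C \<noteq> {}" by auto
  then have "Min (g ` C) \<in> g ` C" using C(2) by simp
  then obtain u where u: "u \<in> C" "g u = Min (g ` C)" by (metis imageE)
  with C(1,3) obtain v where "v \<in> C" "g v < g u" by blast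
  with C(2) u(2) show False by (simp add: not_le[symmetric])
qed

text \<open>The quadratic outgrows the affine minorant, so the objective has bounded sublevel sets.
  In the application the minorant is the subgradient inequality at a minimiser of
  \<open>\<Phi>\<close>.\<close>

lemma prox_is_arg_min:
  fixes R :: "'a::euclidean_space \<Rightarrow> ereal"
  assumes R: "lower_semicontinuous R" and w: "R w \<noteq> \<infinity>"
    and minorant: "\<And>u. ereal (r + v \<bullet> u) \<le> R u" and \<gamma>: "\<gamma> > 0"
  shows "is_arg_min (\<lambda>x. ereal (1/2 * (norm (x - z))\<^sup>2) + ereal \<gamma> * R x) (\<lambda>_. True) (prox \<gamma> R z)"
proof -
  define g where "g = (\<lambda>x. ereal (1/2 * (norm (x - z))\<^sup>2) + ereal \<gamma> * R x)"
  have R_bot: "R x \<noteq> -\<infinity>" for x using minorant[of x] by auto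
  have g_le: "g x \<le> ereal s \<longleftrightarrow> R x \<le> ereal ((s - 1/2 * (norm (x - z))\<^sup>2) / \<gamma>)" for x s
    using R_bot[of x] \<gamma> by (cases "R x") (auto simp: g_def field_simps)
  have g_bot: "g x \<noteq> -\<infinity>" for x using R_bot[of x] \<gamma> by (cases "R x") (auto simp: g_def)
  have closed: "closed {x. g x \<le> ereal s}" for s
    unfolding g_le by (intro closed_lower_semicontinuous_le R continuous_intros) (use \<gamma> in auto)
  obtain s where s: "g w = ereal s"
    using w R_bot[of w] by (cases "R w") (auto simp: g_def)
  \<comment> \<open>On the sublevel set, the minorant turns into
    \<open>t * t \<le> A + B * t\<close> for \<open>t = norm (x - z)\<close>, which fails once
    \<open>t > A + B + 1\<close>.\<close>
  define A where "A = 2 * \<bar>s - \<gamma> * r - \<gamma> * (v \<bullet> z)\<bar>"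
  define B where "B = 2 * \<gamma> * norm v"
  have AB: "A \<ge> 0" "B \<ge> 0" using \<gamma> by (auto simp: A_def B_def)
  have bd: "norm (x - z) \<le> A + B + 1" if "g x \<le> ereal s" for x
  proof (rule ccontr)
    assume far: "\<not> ?thesis"
    from that have "R x \<le> ereal ((s - 1/2 * (norm (x - z))\<^sup>2) / \<gamma>)" by (simp add: g_le)
    with minorant[of x] have "ereal (r + v \<bullet> x) \<le> ereal ((s - 1/2 * (norm (x - z))\<^sup>2) / \<gamma>)"
      by (rule order_trans)
    then have 1: "\<gamma> * r + \<gamma> * (v \<bullet> x) \<le> s - 1/2 * (norm (x - z))\<^sup>2"
      using \<gamma> by (simp add: field_simps)
    have 2: "v \<bullet> x = v \<bullet> z + v \<bullet> (x - z)" by (simp add: inner_diff_right)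
    have "- (norm v * norm (x - z)) \<le> v \<bullet> (x - z)"
      using Cauchy_Schwarz_ineq2[of v "x - z"] by simp
    then have "\<gamma> * - (norm v * norm (x - z)) \<le> \<gamma> * (v \<bullet> (x - z))"
      using \<gamma> by (intro mult_left_mono) auto
    with 1 have "(norm (x - z))\<^sup>2 \<le> 2 * (s - \<gamma> * r - \<gamma> * (v \<bullet> z)) + B * norm (x - z)"
      unfolding 2 B_def by (simp add: algebra_simps)
    also have "\<dots> \<le> A + B * norm (x - z)"
      unfolding A_def by (intro add_right_mono mult_left_mono abs_ge_self) simp
    also have "\<dots> \<le> A * norm (x - z) + B * norm (x - z)"
      using far AB mult_left_mono[of 1 "norm (x - z)" A] by simp
    also have "\<dots> < (A + B + 1) * norm (x - z)"
      using far AB by (simp add: algebra_simps del: zero_less_norm_iff)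
    also have "\<dots> \<le> norm (x - z) * norm (x - z)"
      using far by (intro mult_right_mono) auto
    finally show False by (simp add: power2_eq_square)
  qed
  have "bounded {x. g x \<le> ereal s}"
    unfolding bounded_def by (intro exI[of _ z] exI[of _ "A + B + 1"])
      (use bd in \<open>auto simp: dist_norm norm_minus_commute\<close>)
  then have "\<exists>p. is_arg_min g (\<lambda>_. True) p"
    by (rule ex_is_arg_min_compact_sublevel[OF g_bot closed, where w = w]) (simp add: s)
  then show ?thesis
    unfolding prox_def arg_min_def g_def[symmetric] by (rule someI_ex)
qed

section \<open>Directional derivatives and first-order conditions\<close>

lemma GDERIV_direction:
  fixes h :: "'a::real_inner \<Rightarrow> real"
  assumes "GDERIV h (p + t *\<^sub>R v) :> G"
  shows "((\<lambda>t. h (p + t *\<^sub>R v)) has_real_derivative G \<bullet> v) (at t within S)"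
proof -
  have "((\<lambda>t. p + t *\<^sub>R v) has_derivative (\<lambda>t. t *\<^sub>R v)) (at t within S)"
    by (auto intro!: derivative_eq_intros)
  moreover have "(h has_derivative (\<lambda>x. x \<bullet> G)) (at (p + t *\<^sub>R v))"
    using assms by (simp add: gderiv_def)
  ultimately have "((\<lambda>t. h (p + t *\<^sub>R v)) has_derivative (\<lambda>t. (t *\<^sub>R v) \<bullet> G)) (at t within S)"
    by (rule has_derivative_compose)
  moreover have "(\<lambda>t. (t *\<^sub>R v) \<bullet> G) = (*) (G \<bullet> v)"
    by (auto simp: inner_commute)
  ultimately show ?thesis by (simp add: has_field_derivative_def)
qed

lemma difference_quotient_direction:
  fixes h :: "'a::real_inner \<Rightarrow> real"
  assumes "GDERIV h p :> G"
  shows "((\<lambda>t. (h (p + t *\<^sub>R v) - h p) / t) \<longlongrightarrow> G \<bullet> v) (at_right 0)"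
proof -
  have "GDERIV h (p + 0 *\<^sub>R v) :> G" using assms by simp
  from GDERIV_direction[OF this, of "{0<..}"]
  show ?thesis by (simp add: has_field_derivative_iff)
qed

text \<open>Moving from \<open>p\<close> towards \<open>u\<close> by a fraction \<open>t\<close>
  raises \<open>R\<close> by at most \<open>t * (s - r)\<close>, so minimality limits the decrease
  of \<open>h\<close>; divide by \<open>t\<close> and let it tend to 0. This serves both the
  proximal objective and \<open>\<Phi>\<close>.\<close>

lemma minimizer_subgradient:
  fixes R :: "'a::real_inner \<Rightarrow> ereal"
  assumes R: "proper_fun R" "ereal_convex R" and \<gamma>: "\<gamma> > 0"
    and h: "GDERIV h p :> G"
    and min: "is_arg_min (\<lambda>x. ereal (h x) + ereal \<gamma> * R x) (\<lambda>_. True) p"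
  obtains r where "R p = ereal r" "\<And>u. ereal (r - (G \<bullet> (u - p)) / \<gamma>) \<le> R u"
proof -
  have R_bot: "R u \<noteq> -\<infinity>" for u using R(1) by (simp add: proper_fun_def)
  have le: "ereal (h p) + ereal \<gamma> * R p \<le> ereal (h u) + ereal \<gamma> * R u" for u
    using min by (auto simp: is_arg_min_def not_less)
  obtain w where w: "R w \<noteq> \<infinity>" using R(1) by (auto simp: proper_fun_def)
  then have "R p \<noteq> \<infinity>" using le[of w] R_bot[of w] \<gamma> by (cases "R w") auto
  with R_bot obtain r where r: "R p = ereal r" by (cases "R p") auto
  have "ereal (r - (G \<bullet> (u - p)) / \<gamma>) \<le> R u" for u
  proof (cases "R u")
    case (real s)
    have "eventually (\<lambda>t. - (\<gamma> * (s - r)) \<le> (h (p + t *\<^sub>R (u - p)) - h p) / t) (at_right (0::real))"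
      unfolding eventually_at_right_field
    proof (intro exI[of _ 1] conjI allI impI)
      fix t :: real assume t: "0 < t" "t < 1"
      have eq: "(1 - t) *\<^sub>R p + t *\<^sub>R u = p + t *\<^sub>R (u - p)" by (simp add: algebra_simps)
      have "R (p + t *\<^sub>R (u - p)) \<le> ereal (1 - t) * R p + ereal t * R u"
        using R(2) t unfolding ereal_convex_def by (auto simp flip: eq)
      also have "\<dots> = ereal ((1 - t) * r + t * s)" by (simp add: r real)
      finally have "ereal \<gamma> * R (p + t *\<^sub>R (u - p)) \<le> ereal \<gamma> * ereal ((1 - t) * r + t * s)"
        using \<gamma> by (intro ereal_mult_left_mono) auto
      then have "ereal (h (p + t *\<^sub>R (u - p))) + ereal \<gamma> * R (p + t *\<^sub>R (u - p))
          \<le> ereal (h (p + t *\<^sub>R (u - p))) + ereal \<gamma> * ereal ((1 - t) * r + t * s)"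
        by (rule add_left_mono)
      with le[of "p + t *\<^sub>R (u - p)"]
      have "ereal (h p) + ereal \<gamma> * R p \<le> ereal (h (p + t *\<^sub>R (u - p))) + ereal \<gamma> * ereal ((1 - t) * r + t * s)"
        by (rule order_trans)
      then have "h p + \<gamma> * r \<le> h (p + t *\<^sub>R (u - p)) + \<gamma> * ((1 - t) * r + t * s)" by (simp add: r)
      then show "- (\<gamma> * (s - r)) \<le> (h (p + t *\<^sub>R (u - p)) - h p) / t"
        using t by (simp add: field_simps)
    qed simp
    then have "- (\<gamma> * (s - r)) \<le> G \<bullet> (u - p)"
      using difference_quotient_direction[OF h] by (intro tendsto_lowerbound) auto
    then show ?thesis using \<gamma> by (simp add: real field_simps)
  qed (use R_bot in auto)
  with r show ?thesis by (rule that)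
qed

lemma convex_gradient_inequality:
  fixes F :: "'a::real_inner \<Rightarrow> real"
  assumes F: "convex_on UNIV F" and h: "GDERIV F p :> G"
  shows "F p + G \<bullet> (u - p) \<le> F u"
proof -
  have "eventually (\<lambda>t. (F (p + t *\<^sub>R (u - p)) - F p) / t \<le> F u - F p) (at_right (0::real))"
    unfolding eventually_at_right_field
  proof (intro exI[of _ 1] conjI allI impI)
    fix t :: real assume t: "0 < t" "t < 1"
    have eq: "(1 - t) *\<^sub>R p + t *\<^sub>R u = p + t *\<^sub>R (u - p)" by (simp add: algebra_simps)
    have "F (p + t *\<^sub>R (u - p)) \<le> (1 - t) * F p + t * F u"
      using convex_onD[OF F, of t p u] t by (simp add: eq)
    then show "(F (p + t *\<^sub>R (u - p)) - F p) / t \<le> F u - F p"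
      using t by (simp add: field_simps)
  qed simp
  then have "G \<bullet> (u - p) \<le> F u - F p"
    using difference_quotient_direction[OF h] by (intro tendsto_upperbound) auto
  then show ?thesis by simp
qed

section \<open>Cocoercivity of Lipschitz gradients\<close>

text \<open>Along the segment, \<open>F\<close> minus its claimed quadratic bound has nonpositive
  derivative, by Cauchy-Schwarz and the Lipschitz condition.\<close>

lemma descent_lemma:
  fixes F :: "'a::real_inner \<Rightarrow> real"
  assumes grad: "\<And>z. GDERIV F z :> gradF z" and lip: "L-lipschitz_on UNIV gradF"
  shows "F (p + v) \<le> F p + gradF p \<bullet> v + L / 2 * (norm v)\<^sup>2"
proof -
  let ?\<psi> = "\<lambda>t. F (p + t *\<^sub>R v) - t * (gradF p \<bullet> v) - L / 2 * t\<^sup>2 * (norm v)\<^sup>2"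
  have "?\<psi> 1 \<le> ?\<psi> 0"
  proof (rule DERIV_nonpos_imp_nonincreasing[of 0 1 ?\<psi>])
    fix t :: real assume t: "0 \<le> t" "t \<le> 1"
    let ?D = "gradF (p + t *\<^sub>R v) \<bullet> v - gradF p \<bullet> v - L * t * (norm v)\<^sup>2"
    note [derivative_intros] = GDERIV_direction[OF grad]
    have "(?\<psi> has_real_derivative ?D) (at t)"
      by (auto intro!: derivative_eq_intros simp: power2_eq_square)
    moreover have "?D \<le> 0"
    proof -
      have "(gradF (p + t *\<^sub>R v) - gradF p) \<bullet> v \<le> norm (gradF (p + t *\<^sub>R v) - gradF p) * norm v"
        by (rule norm_cauchy_schwarz)
      also have "\<dots> \<le> (L * norm (t *\<^sub>R v)) * norm v"
        using lipschitz_onD[OF lip, of "p + t *\<^sub>R v" p] by (intro mult_right_mono) (auto simp: dist_norm)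
      finally show ?thesis using t by (simp add: inner_diff_left power2_eq_square)
    qed
    ultimately show "\<exists>y. DERIV ?\<psi> t :> y \<and> y \<le> 0" by blast
  qed simp
  then show ?thesis by simp
qed

text \<open>Evaluate \<open>F\<close> at a gradient step from \<open>q\<close> for the function
  \<open>F\<close> minus its linearisation at \<open>p\<close>: the tangent at \<open>p\<close>
  bounds this value from below, the descent lemma at \<open>q\<close> from above. The step length
  \<beta> gives the best constant.\<close>

lemma convex_lipschitz_gradient_lower_bound:
  fixes F :: "'a::real_inner \<Rightarrow> real"
  assumes F: "convex_on UNIV F" and grad: "\<And>z. GDERIV F z :> gradF z"
    and \<beta>: "\<beta> > 0" and lip: "(1 / \<beta>)-lipschitz_on UNIV gradF"
  shows "F p + gradF p \<bullet> (q - p) + \<beta> / 2 * (norm (gradF q - gradF p))\<^sup>2 \<le> F q"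
proof -
  define g where "g = gradF q - gradF p"
  have 1: "F p + gradF p \<bullet> (q + (- \<beta>) *\<^sub>R g - p) \<le> F (q + (- \<beta>) *\<^sub>R g)"
    by (rule convex_gradient_inequality[OF F grad])
  have 2: "F (q + (- \<beta>) *\<^sub>R g) \<le> F q + gradF q \<bullet> ((- \<beta>) *\<^sub>R g) + 1 / \<beta> / 2 * (norm ((- \<beta>) *\<^sub>R g))\<^sup>2"
    by (rule descent_lemma[OF grad lip])
  have 3: "1 / \<beta> / 2 * (norm ((- \<beta>) *\<^sub>R g))\<^sup>2 = \<beta> / 2 * (norm g)\<^sup>2"
    using \<beta> by (simp add: power_mult_distrib power2_eq_square)
  have 4: "gradF q \<bullet> g = (norm g)\<^sup>2 + gradF p \<bullet> g"
    unfolding power2_norm_eq_inner by (simp add: g_def inner_diff_left)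
  have 5: "\<beta> * (gradF q \<bullet> g) = \<beta> * (norm g)\<^sup>2 + \<beta> * (gradF p \<bullet> g)"
    unfolding 4 by (simp add: algebra_simps)
  have 6: "gradF p \<bullet> (q + (- \<beta>) *\<^sub>R g - p) = gradF p \<bullet> (q - p) - \<beta> * (gradF p \<bullet> g)"
    by (simp add: inner_diff_right)
  show ?thesis
    using 1 2 5 6 unfolding g_def[symmetric] 3 by simp
qed

text \<open>Add the preceding bound to itself with \<open>p\<close> and \<open>q\<close> exchanged;
  the values of \<open>F\<close> cancel.\<close>

lemma Baillon_Haddad:
  fixes F :: "'a::real_inner \<Rightarrow> real"
  assumes "convex_on UNIV F" "\<And>z. GDERIV F z :> gradF z"
    and "\<beta> > 0" "(1 / \<beta>)-lipschitz_on UNIV gradF"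
  shows "\<beta> * (norm (gradF p - gradF q))\<^sup>2 \<le> (gradF p - gradF q) \<bullet> (p - q)"
  using convex_lipschitz_gradient_lower_bound[OF assms, of p q] convex_lipschitz_gradient_lower_bound[OF assms, of q p]
  by (simp add: norm_minus_commute inner_diff_left inner_diff_right)

section \<open>The scalar recursion\<close>

text \<open>The positive parts of the increments of \<open>\<phi>\<close> satisfy a perturbed contraction, hence are summable;
  subtracting their partial sums from \<open>\<phi>\<close> leaves a decreasing sequence.\<close>

lemma inertial_recursion_convergent:
  fixes \<phi> \<delta> e \<alpha> :: "nat \<Rightarrow> real"
  assumes nonneg: "\<And>k. 0 \<le> \<phi> k" "\<And>k. 0 \<le> \<delta> k" "\<And>k. 0 \<le> e k"
    and \<delta>: "summable \<delta>" and \<alpha>: "\<And>k. 0 \<le> \<alpha> k" "\<And>k. \<alpha> k \<le> A" "A < 1"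
    and step: "\<And>k. \<phi> (Suc k) \<le> \<phi> k + \<alpha> k * (\<phi> k - prev \<phi> k) + \<delta> k - e k"
  shows "convergent \<phi>" "summable e"
proof -
  define s where "s k = max 0 (\<phi> k - prev \<phi> k)" for k
  have s0: "s 0 = 0" and s_nonneg: "s k \<ge> 0" for k by (auto simp: s_def prev_def)
  have A: "0 \<le> A" using \<alpha>(1,2)[of 0] by simp
  have \<alpha>_le: "\<alpha> k * (\<phi> k - prev \<phi> k) \<le> A * s k" for k
  proof -
    have "\<alpha> k * (\<phi> k - prev \<phi> k) \<le> \<alpha> k * s k"
      using \<alpha>(1) by (intro mult_left_mono) (auto simp: s_def)
    also have "\<dots> \<le> A * s k" using \<alpha>(2) s_nonneg by (intro mult_right_mono) auto
    finally show ?thesis .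
  qed
  have s_step: "s (Suc k) \<le> A * s k + \<delta> k" for k
  proof -
    have "\<phi> (Suc k) - \<phi> k \<le> A * s k + \<delta> k"
      using step[of k] \<alpha>_le[of k] nonneg(3)[of k] by linarith
    moreover have "0 \<le> A * s k + \<delta> k" using A s_nonneg nonneg(2) by simp
    ultimately show ?thesis by (simp add: s_def[of "Suc k"] prev_def)
  qed
  have sum_\<delta>: "(\<Sum>k<n. \<delta> k) \<le> suminf \<delta>" for n
    using \<delta> nonneg(2) by (intro sum_le_suminf) auto
  have sum_s: "(\<Sum>k<n. s k) \<le> suminf \<delta> / (1 - A)" for n
  proof -
    have "(\<Sum>k<n. s k) \<le> (\<Sum>k<Suc n. s k)" using s_nonneg by simp
    also have "\<dots> = (\<Sum>k<n. s (Suc k))" by (simp add: sum.lessThan_Suc_shift s0 del: sum.lessThan_Suc)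
    also have "\<dots> \<le> (\<Sum>k<n. A * s k + \<delta> k)" by (intro sum_mono s_step)
    also have "\<dots> = A * (\<Sum>k<n. s k) + (\<Sum>k<n. \<delta> k)" by (simp add: sum.distrib sum_distrib_left)
    also have "\<dots> \<le> A * (\<Sum>k<n. s k) + suminf \<delta>" using sum_\<delta> by simp
    finally show ?thesis using \<alpha>(3) by (simp add: field_simps)
  qed
  then have s: "summable s" using s_nonneg by (intro summableI_nonneg_bounded) auto
  \<comment> \<open>The sum includes index \<open>n\<close>, so that \<open>\<psi>\<close> changes
    from \<open>n\<close> to \<open>n + 1\<close> by the increment of \<open>\<phi>\<close> minus
    its positive part.\<close>
  define \<psi> where "\<psi> n = \<phi> n - (\<Sum>k<Suc n. s k)" for n
  have "decseq \<psi>"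
    unfolding decseq_Suc_iff by (auto simp: \<psi>_def s_def[of "Suc _"] prev_def max_def)
  moreover have "\<forall>n. - (suminf \<delta> / (1 - A)) \<le> \<psi> n"
  proof
    fix n show "- (suminf \<delta> / (1 - A)) \<le> \<psi> n"
      using sum_s[of "Suc n"] nonneg(1)[of n] unfolding \<psi>_def by linarith
  qed
  ultimately obtain l where "\<psi> \<longlonglongrightarrow> l" by (rule decseq_convergent)
  moreover have "(\<lambda>n. \<Sum>k<Suc n. s k) \<longlonglongrightarrow> suminf s"
    using s by (intro LIMSEQ_Suc summable_LIMSEQ)
  ultimately have "(\<lambda>n. \<psi> n + (\<Sum>k<Suc n. s k)) \<longlonglongrightarrow> l + suminf s" by (rule tendsto_add)
  then show "convergent \<phi>" by (auto simp: \<psi>_def convergent_def)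
  show "summable e"
  proof (rule summableI_nonneg_bounded)
    fix n
    have "(\<Sum>k<n. e k) \<le> (\<Sum>k<n. (\<phi> k - \<phi> (Suc k)) + s k + \<delta> k)"
    proof (rule sum_mono)
      fix k
      have "A * s k \<le> 1 * s k" using \<alpha>(3) s_nonneg by (intro mult_right_mono) auto
      then show "e k \<le> (\<phi> k - \<phi> (Suc k)) + s k + \<delta> k"
        using step[of k] \<alpha>_le[of k] by linarith
    qed
    also have "\<dots> = (\<phi> 0 - \<phi> n) + (\<Sum>k<n. s k) + (\<Sum>k<n. \<delta> k)"
      by (simp add: sum.distrib sum_lessThan_telescope')
    also have "\<dots> \<le> \<phi> 0 + suminf \<delta> / (1 - A) + suminf \<delta>"
      using sum_s[of n] sum_\<delta>[of n] nonneg(1)[of n] by linarith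
    finally show "(\<Sum>k<n. e k) \<le> \<phi> 0 + suminf \<delta> / (1 - A) + suminf \<delta>" .
  qed (rule nonneg)
qed

section \<open>The one-step estimate\<close>

text \<open>Expand the square of \<open>2 * \<beta> * g + v\<close>. The weight is chosen so that
  the first term on the right matches the cocoercivity bound.\<close>

lemma neg_inner_le_Young:
  fixes g v :: "'a::real_inner"
  assumes "\<beta> > 0"
  shows "- (g \<bullet> v) \<le> \<beta> * (norm g)\<^sup>2 + (norm v)\<^sup>2 / (4 * \<beta>)"
proof -
  have "0 \<le> ((2 * \<beta>) *\<^sub>R g + v) \<bullet> ((2 * \<beta>) *\<^sub>R g + v)" by (rule inner_ge_zero)
  then have "0 \<le> (4 * \<beta>) * (\<beta> * (norm g)\<^sup>2 + g \<bullet> v) + (norm v)\<^sup>2"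
    unfolding power2_norm_eq_inner
    by (simp add: inner_add_left inner_add_right inner_commute[of v g] algebra_simps)
  then show ?thesis using assms by (simp add: field_simps)
qed

text \<open>Here \<open>p\<close>, \<open>x\<close>, \<open>x'\<close> are successive iterates and
  \<open>q\<close> is the step size over \<open>2 * \<beta>\<close>. Polarisation turns
  \<open>key\<close> into squared distances to \<open>w\<close>. In \<open>2 + 2 / c\<close>, the 2
  collects the terms with \<open>a\<close> and \<open>q * b * b\<close>, and \<open>2 / c\<close>
  comes from Young's inequality.\<close>

lemma inertial_step_estimate:
  fixes x x' p w :: "'a::real_inner"
  assumes a: "0 \<le> a" "a \<le> 1" and b: "0 \<le> b" "b \<le> 1"
    and c: "c > 0" and q: "0 \<le> q" "q \<le> 1 - c"
    and key: "2 * ((p - (x + a *\<^sub>R (x - x'))) \<bullet> (p - w)) \<le> q * (norm (p - (x + b *\<^sub>R (x - x'))))\<^sup>2"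
  shows "(norm (p - w))\<^sup>2 \<le> (norm (x - w))\<^sup>2 + a * ((norm (x - w))\<^sup>2 - (norm (x' - w))\<^sup>2)
    + (2 + 2 / c) * (max a b * (norm (x - x'))\<^sup>2) - c / 2 * (norm (p - x))\<^sup>2"
proof -
  define d where "d = x - x'"
  define D where "D = p - x"
  define e where "e = x - w"
  define m where "m = max a b"
  have m: "0 \<le> m" "m \<le> 1" "a \<le> m" "b \<le> m" using a b by (auto simp: m_def)
  have p: "p - w = D + e" and x': "x' - w = e - d"
    and ya: "p - (x + a *\<^sub>R (x - x')) = D - a *\<^sub>R d" and yb: "p - (x + b *\<^sub>R (x - x')) = D - b *\<^sub>R d"
    by (simp_all add: D_def e_def d_def)
  have q1: "q \<le> 1" using q c by simp
  have qb: "0 \<le> q * b" "q * b \<le> b" using q q1 b by (auto simp: mult_left_le_one_le)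
  have qbb: "q * b * b \<le> m"
    using qb b m mult_right_le_one_le[of "q * b" b] by linarith
  \<comment> \<open>The weight spends half of the available \<open>c * (norm D)\<^sup>2\<close> and
    leaves the other half for the conclusion.\<close>
  have young: "2 * (norm D * norm d) \<le> c / 2 * (norm D)\<^sup>2 + 2 / c * (norm d)\<^sup>2"
  proof -
    have "0 \<le> (c * norm D - 2 * norm d)\<^sup>2 / (2 * c)" using c by simp
    also have "\<dots> = c / 2 * (norm D)\<^sup>2 + 2 / c * (norm d)\<^sup>2 - 2 * (norm D * norm d)"
      using c by (simp add: power2_eq_square field_simps)
    finally show ?thesis by simp
  qed
  have "(a - q * b) * (D \<bullet> d) \<le> \<bar>a - q * b\<bar> * \<bar>D \<bullet> d\<bar>"
    by (metis abs_ge_self abs_mult)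
  \<comment> \<open>Both \<open>a\<close> and \<open>q * b\<close> lie in \<open>{0..m}\<close>,
    hence so does the absolute value of their difference. The factor \<open>m\<close> must survive
    on \<open>(norm d)\<^sup>2\<close>, since only that product is summable.\<close>
  also have "\<dots> \<le> m * (norm D * norm d)"
    using a qb m Cauchy_Schwarz_ineq2[of D d] by (intro mult_mono) auto
  finally have "2 * ((a - q * b) * (D \<bullet> d)) \<le> m * (2 * (norm D * norm d))" by simp
  also have "\<dots> \<le> m * (c / 2 * (norm D)\<^sup>2 + 2 / c * (norm d)\<^sup>2)"
    using m young by (intro mult_left_mono)
  also have "\<dots> = m * (c / 2 * (norm D)\<^sup>2) + m * (2 / c * (norm d)\<^sup>2)" by (rule distrib_left)
  also have "\<dots> \<le> c / 2 * (norm D)\<^sup>2 + m * (2 / c * (norm d)\<^sup>2)"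
    using m c by (intro add_right_mono mult_left_le_one_le) auto
  finally have cross: "2 * ((a - q * b) * (D \<bullet> d)) \<le> c / 2 * (norm D)\<^sup>2 + m * (2 / c * (norm d)\<^sup>2)" .
  have "c * (norm D)\<^sup>2 \<le> (1 - q) * (norm D)\<^sup>2" "q * b * b * (norm d)\<^sup>2 \<le> m * (norm d)\<^sup>2"
    "a * (norm d)\<^sup>2 \<le> m * (norm d)\<^sup>2"
    using q qbb m by (auto intro!: mult_right_mono)
  with cross key have "(norm (D + e))\<^sup>2 \<le> (norm e)\<^sup>2 + a * ((norm e)\<^sup>2 - (norm (e - d))\<^sup>2)
    + (2 + 2 / c) * (m * (norm d)\<^sup>2) - c / 2 * (norm D)\<^sup>2"
    unfolding p ya yb power2_norm_eq_inner
    by (simp add: inner_add_left inner_add_right inner_diff_left inner_diff_right inner_commute algebra_simps)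
  then show ?thesis unfolding p x' D_def[symmetric] e_def[symmetric] d_def[symmetric] m_def .
qed

section \<open>Opial's argument and optimality conditions\<close>

text \<open>The sequence is bounded, so it has a cluster point. The distance to that point
  converges, and its limit is 0 along a subsequence.\<close>

lemma Opial_finite_dim:
  fixes x :: "nat \<Rightarrow> 'a::heine_borel"
  assumes "S \<noteq> {}" and conv: "\<And>w. w \<in> S \<Longrightarrow> convergent (\<lambda>k. dist (x k) w)"
    and cluster: "\<And>r l. strict_mono r \<Longrightarrow> (x \<circ> r) \<longlonglongrightarrow> l \<Longrightarrow> l \<in> S"
  shows "\<exists>l\<in>S. x \<longlonglongrightarrow> l"
proof -
  from \<open>S \<noteq> {}\<close> obtain w where "w \<in> S" by blast
  then have "Bseq (\<lambda>k. dist (x k) w)" using conv convergent_imp_Bseq by blast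
  then obtain M where "\<forall>k. dist (x k) w \<le> M" by (auto simp: Bseq_def)
  then have "bounded (range x)" unfolding bounded_def by (auto simp: dist_commute)
  then obtain l r where r: "strict_mono r" "(x \<circ> r) \<longlonglongrightarrow> l"
    using bounded_imp_convergent_subsequence by blast
  then have l: "l \<in> S" by (rule cluster)
  then obtain m where m: "(\<lambda>k. dist (x k) l) \<longlonglongrightarrow> m" using conv by (auto simp: convergent_def)
  have "(\<lambda>k. dist (x (r k)) l) \<longlonglongrightarrow> 0"
    using iffD1[OF tendsto_dist_iff r(2)] by (simp add: o_def)
  moreover have "(\<lambda>k. dist (x (r k)) l) \<longlonglongrightarrow> m"
    using LIMSEQ_subseq_LIMSEQ[OF m r(1)] by (simp add: o_def)
  ultimately have "m = 0" using LIMSEQ_unique by blast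
  with m have "x \<longlonglongrightarrow> l" using tendsto_dist_iff by blast
  with l show ?thesis by blast
qed

text \<open>Fermat's rule: the right-hand side says that \<open>- G\<close> is a subgradient of
  \<open>R\<close> at \<open>p\<close>.\<close>

lemma sum_minimizer_iff_subgradient:
  fixes R :: "'a::real_inner \<Rightarrow> ereal"
  assumes R: "proper_fun R" "ereal_convex R"
    and F: "convex_on UNIV F" and grad: "GDERIV F p :> G"
  shows "p \<in> Argmin (\<lambda>z. ereal (F z) + R z) \<longleftrightarrow>
    (\<exists>r. R p = ereal r \<and> (\<forall>u. ereal (r - G \<bullet> (u - p)) \<le> R u))" (is "?L \<longleftrightarrow> ?R")
proof
  assume ?L
  then have "is_arg_min (\<lambda>z. ereal (F z) + ereal 1 * R z) (\<lambda>_. True) p"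
    by (simp add: Argmin_def flip: one_ereal_def)
  from minimizer_subgradient[OF R zero_less_one grad this] show ?R by auto
next
  assume ?R
  then obtain r where r: "R p = ereal r" "\<And>u. ereal (r - G \<bullet> (u - p)) \<le> R u" by blast
  have "ereal (F p) + R p \<le> ereal (F u) + R u" for u
  proof -
    have "ereal (F p) + R p \<le> ereal (F u) + ereal (r - G \<bullet> (u - p))"
      using convex_gradient_inequality[OF F grad, of u] by (simp add: r(1))
    also have "\<dots> \<le> ereal (F u) + R u" by (intro add_left_mono r)
    finally show ?thesis .
  qed
  then show ?L by (auto simp: Argmin_def is_arg_min_def not_less)
qed

section \<open>Convergence of the iterates\<close>

theorem theorem2p1:
  fixes R :: "real ^ 'n \<Rightarrow> ereal"
    and F :: "real ^ 'n \<Rightarrow> real"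
    and gradF :: "real ^ 'n \<Rightarrow> real ^ 'n"
    and \<Phi> :: "real ^ 'n \<Rightarrow> ereal"
    and \<beta> abar bbar eps_lo eps_hi :: real
    and a b \<gamma> :: "nat \<Rightarrow> real"
    and x :: "nat \<Rightarrow> real ^ 'n"
  assumes R: "proper_fun R" "ereal_convex R" "lower_semicontinuous R"
    and F_convex: "convex_on UNIV F"
    and F_grad: "\<And>z. GDERIV F z :> gradF z"
    and beta_pos: "\<beta> > 0"
    and grad_lipschitz: "(1 / \<beta>)-lipschitz_on UNIV gradF"
    and Phi: "\<Phi> = (\<lambda>z. ereal (F z) + R z)"
    and Argmin_nonempty: "Argmin \<Phi> \<noteq> {}"
    and algorithm:
      "inertial_forward_backward \<beta> gradF R abar bbar eps_lo eps_hi a b \<gamma> x"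
    and abar_less: "abar < 1"
    and summable_inertia:
      "summable (\<lambda>k. max (a k) (b k) * (norm (x k - prev x k))\<^sup>2)"
  shows "\<exists>xstar \<in> Argmin \<Phi>. x \<longlonglongrightarrow> xstar"
proof -
  define ya where "ya k = x k + a k *\<^sub>R (x k - prev x k)" for k
  define yb where "yb k = x k + b k *\<^sub>R (x k - prev x k)" for k
  have bbar: "bbar \<le> 1" and eps: "eps_lo > 0" "eps_hi > 0"
    and a: "\<And>k. 0 \<le> a k" "\<And>k. a k \<le> abar" and b: "\<And>k. 0 \<le> b k" "\<And>k. b k \<le> bbar"
    and \<gamma>: "\<And>k. eps_lo \<le> \<gamma> k" "\<And>k. \<gamma> k \<le> 2 * \<beta> - eps_hi"
    and x_Suc: "\<And>k. x (Suc k) = prox (\<gamma> k) R (ya k - \<gamma> k *\<^sub>R gradF (yb k))"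
    using algorithm unfolding inertial_forward_backward_def ya_def yb_def by (auto simp: Let_def)
  have \<gamma>_pos: "\<gamma> k > 0" for k using \<gamma>(1)[of k] eps by linarith
  have a1: "a k \<le> 1" and b1: "b k \<le> 1" for k using a(2)[of k] b(2)[of k] abar_less bbar by linarith+
  note Argmin_iff = sum_minimizer_iff_subgradient[OF R(1,2) F_convex F_grad, folded Phi]

  \<comment> \<open>Optimality of the proximal step: the left argument of the inner product is a
    subgradient of \<open>R\<close> at \<open>x (Suc k)\<close>.\<close>
  have prox_ineq: "\<exists>r. R (x (Suc k)) = ereal r \<and>
      (\<forall>u. ereal (r + ((ya k - x (Suc k)) /\<^sub>R \<gamma> k - gradF (yb k)) \<bullet> (u - x (Suc k))) \<le> R u)" for k
  proof -
    let ?z = "ya k - \<gamma> k *\<^sub>R gradF (yb k)"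
    let ?p = "x (Suc k)"
    obtain w where "w \<in> Argmin \<Phi>" using Argmin_nonempty by blast
    then obtain r where r: "R w = ereal r" "\<And>u. ereal (r - gradF w \<bullet> (u - w)) \<le> R u"
      using Argmin_iff by blast
    have min: "is_arg_min (\<lambda>x. ereal (1/2 * (norm (x - ?z))\<^sup>2) + ereal (\<gamma> k) * R x) (\<lambda>_. True) ?p"
      unfolding x_Suc[of k]
    proof (rule prox_is_arg_min[OF R(3), where w = w and r = "r + gradF w \<bullet> w" and v = "- gradF w"])
      show "ereal (r + gradF w \<bullet> w + - gradF w \<bullet> u) \<le> R u" for u
        using r(2)[of u] by (simp add: inner_diff_right diff_diff_eq2)
    qed (auto simp: r \<gamma>_pos)
    have "GDERIV (\<lambda>x. 1/2 * (norm (x - ?z))\<^sup>2) ?p :> ?p - ?z"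
      unfolding power2_norm_eq_inner gderiv_def
      by (rule derivative_eq_intros refl | simp add: inner_commute)+
    from minimizer_subgradient[OF R(1,2) \<gamma>_pos this min]
    obtain s where s: "R ?p = ereal s" "\<And>u. ereal (s - ((?p - ?z) \<bullet> (u - ?p)) / \<gamma> k) \<le> R u" by blast
    have "s - ((?p - ?z) \<bullet> (u - ?p)) / \<gamma> k = s + ((ya k - ?p) /\<^sub>R \<gamma> k - gradF (yb k)) \<bullet> (u - ?p)" for u
    proof -
      have "(ya k - ?p) /\<^sub>R \<gamma> k - gradF (yb k) = - ((?p - ?z) /\<^sub>R \<gamma> k)"
        using \<gamma>_pos[of k] by (simp add: algebra_simps)
      then show ?thesis by (simp only: inner_minus_left inner_scaleR_left) (simp add: divide_inverse_commute)
    qed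
    with s show ?thesis by auto
  qed

  \<comment> \<open>This is the margin by which \<open>\<gamma> k / (2 * \<beta>)\<close> stays
    below 1.\<close>
  define c where "c = eps_hi / (2 * \<beta>)"
  have c: "c > 0" using eps beta_pos by (simp add: c_def)
  have estimate: "(norm (x (Suc k) - w))\<^sup>2 \<le> (norm (x k - w))\<^sup>2
      + a k * ((norm (x k - w))\<^sup>2 - (norm (prev x k - w))\<^sup>2)
      + (2 + 2 / c) * (max (a k) (b k) * (norm (x k - prev x k))\<^sup>2)
      - c / 2 * (norm (x (Suc k) - x k))\<^sup>2" if w: "w \<in> Argmin \<Phi>" for w k
  proof (rule inertial_step_estimate[where q = "\<gamma> k / (2 * \<beta>)"])
    show "\<gamma> k / (2 * \<beta>) \<le> 1 - c" "0 \<le> \<gamma> k / (2 * \<beta>)"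
      using \<gamma>(2)[of k] \<gamma>_pos[of k] beta_pos by (auto simp: c_def field_simps)
    let ?p = "x (Suc k)" and ?g = "gradF (yb k) - gradF w"
    obtain r where r: "R w = ereal r" "\<And>u. ereal (r - gradF w \<bullet> (u - w)) \<le> R u"
      using Argmin_iff w by blast
    obtain s where s: "R ?p = ereal s"
      "\<And>u. ereal (s + ((ya k - ?p) /\<^sub>R \<gamma> k - gradF (yb k)) \<bullet> (u - ?p)) \<le> R u"
      using prox_ineq by blast
    \<comment> \<open>Monotonicity of the subdifferential of \<open>R\<close>, between
      \<open>?p\<close> and \<open>w\<close>.\<close>
    have "((ya k - ?p) /\<^sub>R \<gamma> k - gradF (yb k)) \<bullet> (w - ?p) \<le> gradF w \<bullet> (?p - w)"
      using r(2)[of ?p] s(2)[of w] unfolding r(1) s(1) by simp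
    then have "((?p - ya k) /\<^sub>R \<gamma> k) \<bullet> (?p - w) \<le> - (?g \<bullet> (?p - w))"
      by (simp add: inner_diff_left inner_diff_right algebra_simps)
    \<comment> \<open>Splitting \<open>?p - w\<close> at \<open>yb k\<close> makes the cocoercivity
      term cancel the gradient term of Young's inequality.\<close>
    moreover have "- (?g \<bullet> (?p - w)) \<le> (norm (?p - yb k))\<^sup>2 / (4 * \<beta>)"
    proof -
      have "\<beta> * (norm ?g)\<^sup>2 \<le> ?g \<bullet> (yb k - w)"
        by (rule Baillon_Haddad[OF F_convex F_grad beta_pos grad_lipschitz])
      moreover have "?g \<bullet> (?p - w) = ?g \<bullet> (yb k - w) + ?g \<bullet> (?p - yb k)"
        by (simp add: inner_diff_right)
      moreover have "- (?g \<bullet> (?p - yb k)) \<le> \<beta> * (norm ?g)\<^sup>2 + (norm (?p - yb k))\<^sup>2 / (4 * \<beta>)"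
        using beta_pos by (rule neg_inner_le_Young)
      ultimately show ?thesis by linarith
    qed
    moreover have "((?p - ya k) /\<^sub>R \<gamma> k) \<bullet> (?p - w) = ((?p - ya k) \<bullet> (?p - w)) / \<gamma> k"
      by (simp only: inner_scaleR_left divide_inverse_commute)
    ultimately have "((?p - ya k) \<bullet> (?p - w)) / \<gamma> k \<le> (norm (?p - yb k))\<^sup>2 / (4 * \<beta>)"
      by linarith
    then have "(?p - ya k) \<bullet> (?p - w) \<le> (norm (?p - yb k))\<^sup>2 / (4 * \<beta>) * \<gamma> k"
      using \<gamma>_pos[of k] by (simp only: pos_divide_le_eq)
    moreover have "2 * (t / (4 * \<beta>) * \<gamma> k) = \<gamma> k / (2 * \<beta>) * t" for t by simp
    ultimately show "2 * ((?p - (x k + a k *\<^sub>R (x k - prev x k))) \<bullet> (?p - w))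
        \<le> \<gamma> k / (2 * \<beta>) * (norm (?p - (x k + b k *\<^sub>R (x k - prev x k))))\<^sup>2"
      unfolding ya_def yb_def by (metis mult_left_mono zero_le_numeral)
  qed (use a[of k] a1[of k] b[of k] b1[of k] c in auto)
  have m_nonneg: "0 \<le> max (a k) (b k)" for k using a(1)[of k] by simp
  have conv: "convergent (\<lambda>k. (norm (x k - w))\<^sup>2)"
    and steps: "summable (\<lambda>k. c / 2 * (norm (x (Suc k) - x k))\<^sup>2)" if "w \<in> Argmin \<Phi>" for w
  proof -
    have "prev (\<lambda>k. (norm (x k - w))\<^sup>2) k = (norm (prev x k - w))\<^sup>2" for k
      by (simp add: prev_def split: nat.split)
    note * = inertial_recursion_convergent[where \<phi> = "\<lambda>k. (norm (x k - w))\<^sup>2" and \<alpha> = a and A = abar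
        and \<delta> = "\<lambda>k. (2 + 2 / c) * (max (a k) (b k) * (norm (x k - prev x k))\<^sup>2)"
        and e = "\<lambda>k. c / 2 * (norm (x (Suc k) - x k))\<^sup>2", unfolded this,
        OF _ _ _ summable_mult[OF summable_inertia] a abar_less estimate[OF that]]
    show "convergent (\<lambda>k. (norm (x k - w))\<^sup>2)" "summable (\<lambda>k. c / 2 * (norm (x (Suc k) - x k))\<^sup>2)"
      by (rule *; use c m_nonneg in simp)+
  qed
  have D: "(\<lambda>k. x (Suc k) - x k) \<longlonglongrightarrow> 0"
  proof -
    have "(\<lambda>k. c / 2 * (norm (x (Suc k) - x k))\<^sup>2) \<longlonglongrightarrow> 0"
      using Argmin_nonempty steps by (auto intro: summable_LIMSEQ_zero)
    then have "(\<lambda>k. 2 / c * (c / 2 * (norm (x (Suc k) - x k))\<^sup>2)) \<longlonglongrightarrow> 2 / c * 0"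
      by (intro tendsto_intros)
    then have "(\<lambda>k. (norm (x (Suc k) - x k))\<^sup>2) \<longlonglongrightarrow> 0" using c by simp
    then have "(\<lambda>k. sqrt ((norm (x (Suc k) - x k))\<^sup>2)) \<longlonglongrightarrow> sqrt 0" by (intro tendsto_intros)
    then show ?thesis by (simp add: tendsto_norm_zero_iff)
  qed
  \<comment> \<open>After a shift by one index this is \<open>D\<close>, because
    \<open>prev x (Suc k) = x k\<close>.\<close>
  have d: "(\<lambda>k. x k - prev x k) \<longlonglongrightarrow> 0"
    by (rule LIMSEQ_imp_Suc) (use D in \<open>simp add: prev_def\<close>)
  have scaled: "(\<lambda>k. t k *\<^sub>R (x k - prev x k)) \<longlonglongrightarrow> 0" if "\<And>k. 0 \<le> t k" "\<And>k. t k \<le> 1" for t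
  proof (rule Lim_null_comparison[OF _ tendsto_norm_zero[OF d]])
    show "\<forall>\<^sub>F k in sequentially. norm (t k *\<^sub>R (x k - prev x k)) \<le> norm (x k - prev x k)"
      using that by (simp add: mult_left_le_one_le)
  qed
  have cluster: "l \<in> Argmin \<Phi>" if r: "strict_mono r" and l: "(x \<circ> r) \<longlonglongrightarrow> l" for r l
  proof -
    have sub: "(\<lambda>k. f (r k)) \<longlonglongrightarrow> 0" if "f \<longlonglongrightarrow> 0" for f :: "nat \<Rightarrow> real ^ 'n"
      using LIMSEQ_subseq_LIMSEQ[OF that r] by (simp add: o_def)
    have xr: "(\<lambda>k. x (r k)) \<longlonglongrightarrow> l" using l by (simp add: o_def)
    have pr: "(\<lambda>k. x (Suc (r k))) \<longlonglongrightarrow> l"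
      using tendsto_add[OF sub[OF D] xr] by simp
    have ybr: "(\<lambda>k. yb (r k)) \<longlonglongrightarrow> l"
      using tendsto_add[OF xr sub[OF scaled[OF b(1) b1]]] by (simp add: yb_def)
    have "continuous_on UNIV gradF" using grad_lipschitz by (rule lipschitz_on_continuous_on)
    then have gr: "(\<lambda>k. gradF (yb (r k))) \<longlonglongrightarrow> gradF l"
      using ybr by (auto intro: continuous_on_tendsto_compose)
    have yap: "(\<lambda>k. ya k - x (Suc k)) \<longlonglongrightarrow> 0"
      using tendsto_diff[OF scaled[OF a(1) a1] D] by (simp add: ya_def algebra_simps)
    \<comment> \<open>The lower bound \<open>eps_lo\<close> on the step sizes keeps the division
      harmless.\<close>
    have "(\<lambda>k. (ya k - x (Suc k)) /\<^sub>R \<gamma> k) \<longlonglongrightarrow> 0"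
    proof (rule Lim_null_comparison)
      show "\<forall>\<^sub>F k in sequentially. norm ((ya k - x (Suc k)) /\<^sub>R \<gamma> k) \<le> norm (ya k - x (Suc k)) / eps_lo"
      proof (rule always_eventually, rule allI)
        fix k
        have "norm (ya k - x (Suc k)) / \<gamma> k \<le> norm (ya k - x (Suc k)) / eps_lo"
          using \<gamma>(1) eps \<gamma>_pos by (intro divide_left_mono) auto
        then show "norm ((ya k - x (Suc k)) /\<^sub>R \<gamma> k) \<le> norm (ya k - x (Suc k)) / eps_lo"
          using \<gamma>_pos[of k] by (simp add: divide_inverse mult.commute)
      qed
      show "(\<lambda>k. norm (ya k - x (Suc k)) / eps_lo) \<longlonglongrightarrow> 0"
        using tendsto_divide[OF tendsto_norm_zero[OF yap] tendsto_const[of eps_lo]] eps by simp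
    qed
    then have v: "(\<lambda>k. (ya (r k) - x (Suc (r k))) /\<^sub>R \<gamma> (r k) - gradF (yb (r k))) \<longlonglongrightarrow> 0 - gradF l"
      by (intro tendsto_diff sub gr)
    \<comment> \<open>The subgradient inequality of the proximal step, solved for its value of
      \<open>R\<close>, passes to the limit by lower semicontinuity.\<close>
    have le: "R l \<le> ereal (s + gradF l \<bullet> (u - l))" if u: "R u = ereal s" for u s
    proof (rule lower_semicontinuous_le_lim[OF R(3) pr])
      let ?v = "\<lambda>k. (ya (r k) - x (Suc (r k))) /\<^sub>R \<gamma> (r k) - gradF (yb (r k))"
      show "R (x (Suc (r k))) \<le> ereal (s - ?v k \<bullet> (u - x (Suc (r k))))" for k
      proof -
        obtain t where "R (x (Suc (r k))) = ereal t" "ereal (t + ?v k \<bullet> (u - x (Suc (r k)))) \<le> R u"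
          using prox_ineq[of "r k"] by blast
        then show ?thesis by (simp add: u)
      qed
      have "(\<lambda>k. s - ?v k \<bullet> (u - x (Suc (r k)))) \<longlonglongrightarrow> s - (0 - gradF l) \<bullet> (u - l)"
        by (intro tendsto_intros v pr)
      then show "(\<lambda>k. s - ?v k \<bullet> (u - x (Suc (r k)))) \<longlonglongrightarrow> s + gradF l \<bullet> (u - l)" by simp
    qed
    have R_bot: "R u \<noteq> -\<infinity>" for u using R(1) by (simp add: proper_fun_def)
    \<comment> \<open>Any iterate after the first is a point where \<open>R\<close> is finite; it
      makes \<open>R l\<close> finite.\<close>
    obtain u s where "R u = ereal s" using prox_ineq by blast
    from le[OF this] R_bot obtain t where t: "R l = ereal t" by (cases "R l") auto
    have "ereal (t - gradF l \<bullet> (u - l)) \<le> R u" for u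
      using le[of u] R_bot[of u] t by (cases "R u") auto
    with t show ?thesis unfolding Argmin_iff by blast
  qed
  show ?thesis
  proof (rule Opial_finite_dim[OF Argmin_nonempty])
    fix w assume "w \<in> Argmin \<Phi>"
    from conv[OF this] obtain l where "(\<lambda>k. (norm (x k - w))\<^sup>2) \<longlonglongrightarrow> l" by (auto simp: convergent_def)
    then have "(\<lambda>k. sqrt ((norm (x k - w))\<^sup>2)) \<longlonglongrightarrow> sqrt l" by (rule tendsto_real_sqrt)
    then show "convergent (\<lambda>k. dist (x k) w)" by (auto simp: convergent_def dist_norm)
  qed (rule cluster)
qed

end
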